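(* Let $I\subseteq\mathbb R$ be an open interval, $n\ge1$, and let $f:I\times\mathbb R^n\to\mathbb R^n$ be a continuous function which is $C^3$ in $x$. For $(\tau,\xi)\in I\times\mathbb R^n$ let $\varphi(t,\tau,\xi)$, $t\in I(\tau,\xi)$, be the maximal solution of $\frac{dx}{dt}=f(t,x)$ with $\varphi(\tau,\tau,\xi)=\xi$. Then the system $\frac{dx}{dt}=f(t,x)$ is a vector Riccati equation if and only if its general solution is a fractional linear vector function of $\xi$, i.e. if and only if there exist functions of $(t,\tau)\in I\times I$, namely an $n\times n$ matrix $A(t,\tau)$, columns $\beta(t,\tau),\gamma(t,\tau)\in\mathbb R^n$ and a scalar $\delta(t,\tau)$, with $[\gamma^T(t,\tau)\ \ \delta(t,\tau)]\ne 0^T$, such that for all $(\tau,\xi)\in I\times\mathbb R^n$ and all $t\in I(\tau,\xi)$ one has $\gamma^T(t,\tau)\xi+\delta(t,\tau)\neq0$ and $$\varphi(t,\tau,\xi)=\frac{A(t,\tau)\xi+\beta(t,\tau)}{\gamma^T(t,\tau)\xi+\delta(t,\tau)}.$$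
   Context: The system is called a vector Riccati equation if there are continuous vector functions $a,c:I\to\mathbb R^n$ and a continuous $n\times n$ matrix function $B$ on $I$ such that $f(t,x)=a(t)+B(t)x+(c(t)^Tx)\,x$ for all $(t,x)\in I\times\mathbb R^n$. "$C^3$ in $x$" means that the partial derivatives with respect to $x$ up to order $3$ exist and are continuous on $I\times\mathbb R^n$. $I(\tau,\xi)\subseteq I$ is the maximal interval of existence of the solution through $(\tau,\xi)$. *)

theory Defs
  imports "HOL-Analysis.Analysis"
begin

text \<open>\<open>C\<^sup>k\<close> in \<open>x\<close>: all iterated partial derivatives with respect to the components of \<open>x\<close>, up to
  order \<open>k\<close>, exist and are jointly continuous on \<open>I \<times> \<real>\<^sup>n\<close>. The function \<open>g\<close> is the
  \<open>j\<close>-th partial derivative; its values for \<open>t\<close> outside \<open>I\<close> are irrelevant.\<close>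

primrec Ck_in_x :: "nat \<Rightarrow> real set \<Rightarrow> (real \<Rightarrow> real^'n \<Rightarrow> real^'n) \<Rightarrow> bool" where
  "Ck_in_x 0 I f \<longleftrightarrow> continuous_on (I \<times> UNIV) (\<lambda>(t, x). f t x)"
| "Ck_in_x (Suc k) I f \<longleftrightarrow>
     continuous_on (I \<times> UNIV) (\<lambda>(t, x). f t x) \<and>
     (\<forall>j. \<exists>g. (\<forall>t\<in>I. \<forall>x. ((\<lambda>s. f t (x + s *\<^sub>R axis j 1)) has_vector_derivative g t x) (at 0))
              \<and> Ck_in_x k I g)"

definition vector_riccati :: "real set \<Rightarrow> (real \<Rightarrow> real^'n \<Rightarrow> real^'n) \<Rightarrow> bool" where
  "vector_riccati I f \<longleftrightarrow>
     (\<exists>(a :: real \<Rightarrow> real^'n) (B :: real \<Rightarrow> real^'n^'n) (c :: real \<Rightarrow> real^'n).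
        continuous_on I a \<and> continuous_on I B \<and> continuous_on I c \<and>
        (\<forall>t\<in>I. \<forall>x. f t x = a t + B t *v x + (c t \<bullet> x) *\<^sub>R x))"

definition ode_solution ::
    "real set \<Rightarrow> (real \<Rightarrow> real^'n \<Rightarrow> real^'n) \<Rightarrow> real set \<Rightarrow> (real \<Rightarrow> real^'n) \<Rightarrow> bool" where
  "ode_solution I f J x \<longleftrightarrow>
     open J \<and> is_interval J \<and> J \<subseteq> I \<and> (\<forall>t\<in>J. (x has_vector_derivative f t (x t)) (at t))"

text \<open>Maximal means not extendable to a solution on a strictly larger interval. Only the
  restriction of \<open>x\<close> to \<open>J\<close> matters.\<close>

definition maximal_solution ::
    "real set \<Rightarrow> (real \<Rightarrow> real^'n \<Rightarrow> real^'n) \<Rightarrow> real \<Rightarrow> real^'n \<Rightarrow> real set \<Rightarrow> (real \<Rightarrow> real^'n) \<Rightarrow> bool" where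
  "maximal_solution I f \<tau> \<xi> J x \<longleftrightarrow>
     ode_solution I f J x \<and> \<tau> \<in> J \<and> x \<tau> = \<xi> \<and>
     (\<forall>K y. ode_solution I f K y \<and> J \<subseteq> K \<and> (\<forall>t\<in>J. y t = x t) \<longrightarrow> K = J)"

end

theory Submission
  imports Defs
begin

text \<open>
  If \<open>f t x = a + B x + (c \<bullet> x) x\<close>, then \<open>x = u / v\<close> turns the equation into the linear system
  \<open>u' = B u + v a\<close>, \<open>v' = - c \<bullet> u\<close> on \<open>\<real>\<^sup>n \<times> \<real>\<close>. Its transition matrix is defined on all of
  \<open>I \<times> I\<close>; its blocks are \<open>A, \<beta>, \<gamma>, \<delta>\<close>, and \<open>(\<gamma>, \<delta>) \<noteq> 0\<close> because it is invertible.

  Conversely, near \<open>t = \<tau>\<close> one may normalise \<open>\<delta> = 1\<close>. Adding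
  \<open>(1 + \<gamma> \<bullet> v) \<phi>(v) = A v + \<beta>\<close> and \<open>(1 - \<gamma> \<bullet> v) \<phi>(- v) = - A v + \<beta>\<close> eliminates \<open>A\<close>, so the existence of
  \<open>\<partial>\<phi>/\<partial>t\<close> at \<open>t = \<tau>\<close> forces \<open>\<gamma> \<bullet> v\<close>, and then \<open>A v\<close>, to be differentiable at \<open>\<tau>\<close>. The derivatives
  are linear in \<open>v\<close>, and they express \<open>f \<tau>\<close> as a quadratic map of Riccati type.
\<close>

text \<open>Expanding \<open>x\<close> in the standard basis gives the vector representing
  \<open>g\<close>. This is how the columns \<open>\<gamma>\<close> and \<open>c\<close> are later
  read off from scalar linear maps.\<close>

lemma linear_functional_inner:
  fixes g :: "real^'n \<Rightarrow> real"
  assumes "linear g"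
  shows "(\<chi> i. g (axis i 1)) \<bullet> x = g x"
proof -
  have "g x = g (\<Sum>i\<in>UNIV. x $ i *\<^sub>R axis i 1)"
    using basis_expansion[of x] by (simp add: scalar_mult_eq_scaleR)
  also have "\<dots> = (\<Sum>i\<in>UNIV. x $ i * g (axis i 1))"
    using assms by (simp add: linear_sum linear_scale)
  finally show ?thesis
    by (simp add: inner_vec_def mult.commute)
qed

subsection \<open>Linear differential equations\<close>

text \<open>The compact interval supplies integrability and uniform bounds, while keeping both
  points in its interior allows derivatives within the window to be turned into two-sided
  ones.\<close>

lemma open_interval_compact_window:
  fixes I :: "real set"
  assumes "open I" "is_interval I" "s \<in> I" "t \<in> I"
  obtains p q where "{p..q} \<subseteq> I" "s \<in> {p<..<q}" "t \<in> {p<..<q}"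
proof -
  have *: "\<exists>e>0. x - e \<in> I \<and> x + e \<in> I" if x: "x \<in> I" for x
  proof -
    obtain e where "e > 0" "cball x e \<subseteq> I"
      using assms(1) x open_contains_cball by metis
    then have "x - e \<in> I" "x + e \<in> I"
      by (auto simp: dist_real_def intro!: subsetD[OF \<open>cball x e \<subseteq> I\<close>])
    then show ?thesis using \<open>e > 0\<close> by blast
  qed
  obtain d e where d: "d > 0" "min s t - d \<in> I" and e: "e > 0" "max s t + e \<in> I"
    using *[of "min s t"] *[of "max s t"] assms(3,4) unfolding max_def min_def by metis
  show thesis
  proof
    show "{min s t - d..max s t + e} \<subseteq> I"
      using mem_is_interval_1_I[OF assms(2) d(2) e(2)] by auto
  qed (use d e in auto)
qed

lemma open_interval_antiderivative:
  fixes g :: "real \<Rightarrow> 'a::banach"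
  assumes I: "open I" "is_interval I" and "\<tau> \<in> I" and g: "continuous_on I g"
  obtains G where "G \<tau> = 0" "\<And>t. t \<in> I \<Longrightarrow> (G has_vector_derivative g t) (at t)"
proof -
  \<comment> \<open>This is the oriented integral from \<tau> to \<open>t\<close>: for every
    \<open>t\<close> at least one of the two intervals is empty or a single point and contributes
    0.\<close>
  let ?G = "\<lambda>t. integral {\<tau>..t} g - integral {t..\<tau>} g"
  show thesis
  proof (rule that[of ?G])
    show "?G \<tau> = 0" by simp
    show "(?G has_vector_derivative g t) (at t)" if t: "t \<in> I" for t
    proof -
      obtain p q where pq: "{p..q} \<subseteq> I" "\<tau> \<in> {p<..<q}" "t \<in> {p<..<q}"
        using open_interval_compact_window[OF I \<open>\<tau> \<in> I\<close> t] .
      have cont: "continuous_on {p..q} g"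
        using g pq(1) continuous_on_subset by blast
      have int: "g integrable_on {a..b}" if "p \<le> a" "b \<le> q" for a b
        using cont that by (intro integrable_continuous_real) (auto elim: continuous_on_subset)
      \<comment> \<open>On the window \<open>?G\<close> differs by a constant from the integral with
        fixed lower end \<open>p\<close>, to which the fundamental theorem of calculus
        applies.\<close>
      have eq: "integral {p..s} g - integral {p..\<tau>} g = ?G s" if "s \<in> {p<..<q}" for s
      proof (cases "\<tau> \<le> s")
        case True
        then show ?thesis
          using Henstock_Kurzweil_Integration.integral_combine[of p \<tau> s g] int[of p s] pq(2) that
          by (cases "s = \<tau>") (auto simp: algebra_simps)
      next
        case False
        then show ?thesis
          using Henstock_Kurzweil_Integration.integral_combine[of p s \<tau> g] int[of p \<tau>] pq(2) that
          by (auto simp: algebra_simps)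
      qed
      have "((\<lambda>s. integral {p..s} g - integral {p..\<tau>} g) has_vector_derivative g t - 0) (at t within {p..q})"
        using pq(3) by (intro has_vector_derivative_diff integral_has_vector_derivative[OF cont]
            has_vector_derivative_const) auto
      then have "((\<lambda>s. integral {p..s} g - integral {p..\<tau>} g) has_vector_derivative g t) (at t)"
        using at_within_Icc_at[of p t q] pq(3) by simp
      then show ?thesis
        by (rule has_vector_derivative_transform_within_open[of _ _ _ "{p<..<q}"]) (use pq eq in auto)
    qed
  qed
qed

section \<open>Picard estimates, uniqueness and existence for linear systems\<close>

text \<open>Running through the segment by an affine parameter \<open>r\<close> in [0, 1] treats
  \<open>t\<close> on either side of \<tau> alike and reduces the claim to comparison with a scalar
  majorant.\<close>

lemma norm_le_of_derivative_power_bound: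
  fixes u :: "real \<Rightarrow> 'a::real_normed_vector"
  assumes der: "\<And>s. s \<in> closed_segment \<tau> t \<Longrightarrow> (u has_vector_derivative u' s) (at s)"
    and bnd: "\<And>s. s \<in> closed_segment \<tau> t \<Longrightarrow> norm (u' s) \<le> C * \<bar>s - \<tau>\<bar> ^ k"
    and "u \<tau> = 0"
  shows "norm (u t) \<le> C * \<bar>t - \<tau>\<bar> ^ Suc k / Suc k"
proof -
  define p where "p r = \<tau> + r * (t - \<tau>)" for r
  have p_in: "p r \<in> closed_segment \<tau> t" if "0 \<le> r" "r \<le> 1" for r
    using that unfolding p_def closed_segment_def by (auto simp: algebra_simps intro!: exI[of _ r])
  have p_der: "(p has_vector_derivative (t - \<tau>)) (at r)" for r
    unfolding p_def by (auto intro!: derivative_eq_intros)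
  have u_der: "((u \<circ> p) has_vector_derivative (t - \<tau>) *\<^sub>R u' (p r)) (at r)"
    if "0 \<le> r" "r \<le> 1" for r
    by (intro vector_diff_chain_at p_der der p_in that)
  \<comment> \<open>The powers of 1 and 0 stay unevaluated so that the right side is literally the
    majorant at 1 minus the majorant at 0.\<close>
  have "norm ((u \<circ> p) 1 - (u \<circ> p) 0) \<le>
      C * \<bar>t - \<tau>\<bar> ^ Suc k / Suc k * 1 ^ Suc k - C * \<bar>t - \<tau>\<bar> ^ Suc k / Suc k * 0 ^ Suc k"
  proof (rule differentiable_bound_general[where \<phi> = "\<lambda>r. C * \<bar>t - \<tau>\<bar> ^ Suc k / Suc k * r ^ Suc k"])
    show "continuous_on {0..1} (u \<circ> p)"
      using u_der by (intro continuous_at_imp_continuous_on ballI)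
        (metis atLeastAtMost_iff has_vector_derivative_continuous)
    show "((\<lambda>r. C * \<bar>t - \<tau>\<bar> ^ Suc k / Suc k * r ^ Suc k) has_vector_derivative
        C * \<bar>t - \<tau>\<bar> ^ Suc k * r ^ k) (at r)" for r
      unfolding has_real_derivative_iff_has_vector_derivative[symmetric]
      by (rule derivative_eq_intros refl | simp add: divide_simps del: of_nat_Suc)+
    show "norm ((t - \<tau>) *\<^sub>R u' (p r)) \<le> C * \<bar>t - \<tau>\<bar> ^ Suc k * r ^ k" if "0 < r" "r < 1" for r
    proof -
      have "norm ((t - \<tau>) *\<^sub>R u' (p r)) \<le> \<bar>t - \<tau>\<bar> * (C * \<bar>p r - \<tau>\<bar> ^ k)"
        using bnd[OF p_in[of r]] that by (auto intro!: mult_left_mono)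
      also have "\<dots> = C * \<bar>t - \<tau>\<bar> ^ Suc k * r ^ k"
        using that by (simp add: p_def abs_mult power_mult_distrib)
      finally show ?thesis .
    qed
    show "((u \<circ> p) has_vector_derivative (t - \<tau>) *\<^sub>R u' (p r)) (at r)" if "0 < r" "r < 1" for r
      using that by (intro u_der) auto
  qed (auto intro!: continuous_intros)
  then show ?thesis
    using \<open>u \<tau> = 0\<close> by (simp add: p_def)
qed

text \<open>Each integration gains a factor \<open>K * \<bar>t - \<tau>\<bar> / Suc k\<close>. Since
  \<open>u 0\<close> need only be bounded, the estimate serves both the terms of the Picard series
  and, with a constant sequence, uniqueness.\<close>

lemma picard_iterate_bound:
  fixes L :: "real \<Rightarrow> 'a::real_normed_vector \<Rightarrow>\<^sub>L 'a"
  assumes S: "is_interval S" "\<tau> \<in> S"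
    and L: "\<And>s. s \<in> S \<Longrightarrow> norm (L s) \<le> K"
    and u0: "\<And>s. s \<in> S \<Longrightarrow> norm (u 0 s) \<le> M"
    and der: "\<And>k s. s \<in> S \<Longrightarrow> (u (Suc k) has_vector_derivative L s (u k s)) (at s)"
    and init: "\<And>k. u (Suc k) \<tau> = 0"
    and "t \<in> S"
  shows "norm (u k t) \<le> M * (K * \<bar>t - \<tau>\<bar>) ^ k / fact k"
  using \<open>t \<in> S\<close>
proof (induction k arbitrary: t)
  case 0
  then show ?case using u0 by simp
next
  case (Suc k)
  have seg: "closed_segment \<tau> t \<subseteq> S"
    using S Suc.prems is_interval_convex_1 closed_segment_subset by metis
  have "norm (u (Suc k) t) \<le> (M * K ^ Suc k / fact k) * \<bar>t - \<tau>\<bar> ^ Suc k / Suc k"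
  proof (rule norm_le_of_derivative_power_bound)
    fix s assume "s \<in> closed_segment \<tau> t"
    then have s: "s \<in> S" using seg by blast
    show "(u (Suc k) has_vector_derivative L s (u k s)) (at s)"
      using der s by blast
    have "norm (L s (u k s)) \<le> norm (L s) * norm (u k s)" by (rule norm_blinfun)
    also have "\<dots> \<le> K * (M * (K * \<bar>s - \<tau>\<bar>) ^ k / fact k)"
      by (intro mult_mono L[OF s] Suc.IH[OF s] order_trans[OF norm_ge_zero L[OF s]] norm_ge_zero)
    finally show "norm (L s (u k s)) \<le> M * K ^ Suc k / fact k * \<bar>s - \<tau>\<bar> ^ k"
      by (simp add: power_mult_distrib mult_ac)
  qed (rule init)
  then show ?case by (simp add: power_mult_distrib mult_ac)
qed

text \<open>A solution vanishing at \<tau> is its own next Picard term, so the sequence constantly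
  equal to \<open>z\<close> obeys the Picard bound for every \<open>k\<close>. The bounds are
  multiples of the terms of an exponential series and tend to 0.\<close>

lemma linear_ode_zero_unique:
  fixes L :: "real \<Rightarrow> 'a::real_normed_vector \<Rightarrow>\<^sub>L 'a"
  assumes J: "is_interval J" "\<tau> \<in> J" "t \<in> J"
    and L: "continuous_on J L"
    and der: "\<And>s. s \<in> J \<Longrightarrow> (z has_vector_derivative L s (z s)) (at s)"
    and "z \<tau> = 0"
  shows "z t = 0"
proof -
  let ?S = "closed_segment \<tau> t"
  have sub: "?S \<subseteq> J"
    using J is_interval_convex_1 closed_segment_subset by metis
  have "continuous_on ?S L" "continuous_on ?S z"
    using L der sub continuous_on_subset
    by (blast, intro continuous_at_imp_continuous_on) (blast intro: has_vector_derivative_continuous)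
  then have "bounded (L ` ?S)" "bounded (z ` ?S)"
    by (auto intro!: compact_imp_bounded compact_continuous_image)
  then obtain K M where KM: "\<And>s. s \<in> ?S \<Longrightarrow> norm (L s) \<le> K" "\<And>s. s \<in> ?S \<Longrightarrow> norm (z s) \<le> M"
    unfolding bounded_iff by (metis imageI)
  have "norm (z t) \<le> M * (K * \<bar>t - \<tau>\<bar>) ^ k / fact k" for k
    using picard_iterate_bound[where u = "\<lambda>_. z" and L = L and S = ?S and \<tau> = \<tau>] KM der sub \<open>z \<tau> = 0\<close>
    by (auto simp: is_interval_convex_1 subset_iff)
  moreover have "(\<lambda>k. M * (K * \<bar>t - \<tau>\<bar>) ^ k / fact k) \<longlonglongrightarrow> 0"
    using tendsto_mult_left[OF summable_LIMSEQ_zero[OF summable_exp[of "K * \<bar>t - \<tau>\<bar>"]], of M]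
    by (simp add: field_simps)
  ultimately have "norm (z t) \<le> 0"
    by (intro LIMSEQ_le_const) auto
  then show ?thesis by simp
qed

lemma linear_ode_unique:
  fixes L :: "real \<Rightarrow> 'a::real_normed_vector \<Rightarrow>\<^sub>L 'a"
  assumes "is_interval J" "\<tau> \<in> J" "t \<in> J" "continuous_on J L"
    and "\<And>s. s \<in> J \<Longrightarrow> (y has_vector_derivative L s (y s)) (at s)"
    and "\<And>s. s \<in> J \<Longrightarrow> (z has_vector_derivative L s (z s)) (at s)"
    and "y \<tau> = z \<tau>"
  shows "y t = z t"
proof -
  have "y t - z t = 0"
    by (rule linear_ode_zero_unique[of J \<tau> t L "\<lambda>s. y s - z s"])
      (use assms in \<open>auto simp: blinfun.diff_right intro!: has_vector_derivative_diff\<close>)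
  then show ?thesis by simp
qed

text \<open>The solution is the sum of the Picard series. Every term is defined on all of
  \<open>I\<close>, so no local solutions have to be glued; a compact window serves only to
  differentiate the sum near a given \<open>t\<close>.\<close>

lemma linear_ode_exists:
  fixes L :: "real \<Rightarrow> 'a::banach \<Rightarrow>\<^sub>L 'a"
  assumes I: "open I" "is_interval I" and \<tau>: "\<tau> \<in> I" and L: "continuous_on I L"
  obtains y where "y \<tau> = y0" "\<And>t. t \<in> I \<Longrightarrow> (y has_vector_derivative L t (y t)) (at t)"
proof -
  define P where "P = rec_nat (\<lambda>_. y0)
    (\<lambda>_ g. SOME G. G \<tau> = 0 \<and> (\<forall>t\<in>I. (G has_vector_derivative L t (g t)) (at t)))"
  have P0: "P 0 t = y0" for t by (simp add: P_def)
  have ex: "\<exists>G. G \<tau> = 0 \<and> (\<forall>t\<in>I. (G has_vector_derivative L t (g t)) (at t))"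
    if "continuous_on I g" for g
    using open_interval_antiderivative[OF I \<tau>, of "\<lambda>t. L t (g t)"] L that
    by (metis blinfun.continuous_on)
  have PSuc: "continuous_on I (P k) \<and> P (Suc k) \<tau> = 0 \<and>
      (\<forall>t\<in>I. (P (Suc k) has_vector_derivative L t (P k t)) (at t))" for k
  proof (induction k)
    case 0
    have "continuous_on I (P 0)" by (simp add: P_def)
    then show ?case using someI_ex[OF ex[of "P 0"]] by (simp add: P_def)
  next
    case (Suc k)
    then have "continuous_on I (P (Suc k))"
      by (intro continuous_at_imp_continuous_on) (blast intro: has_vector_derivative_continuous)
    then show ?case using someI_ex[OF ex[of "P (Suc k)"]] by (simp add: P_def)
  qed
  define y where "y t = (\<Sum>k. P k t)" for t
  show thesis
  proof
    have "P k \<tau> = 0" if "k \<noteq> 0" for k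
      using PSuc that by (metis not0_implies_Suc)
    then show "y \<tau> = y0"
      unfolding y_def using P0 suminf_finite[of "{0}" "\<lambda>k. P k \<tau>"] by auto
    fix t assume t: "t \<in> I"
    obtain p q where pq: "{p..q} \<subseteq> I" "\<tau> \<in> {p<..<q}" "t \<in> {p<..<q}"
      using open_interval_compact_window[OF I \<tau> t] .
    let ?S = "{p<..<q}"
    have "bounded (L ` {p..q})"
      using L pq(1) by (auto intro!: compact_imp_bounded compact_continuous_image elim: continuous_on_subset)
    then obtain K where K: "\<And>s. s \<in> {p..q} \<Longrightarrow> norm (L s) \<le> K"
      unfolding bounded_iff by (metis imageI)
    have "0 \<le> K" using K[of \<tau>] pq(2) norm_ge_zero order_trans by (metis greaterThanLessThan_iff atLeastAtMost_iff less_imp_le)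
    have bound: "norm (P k s) \<le> norm y0 * ((K * (q - p)) ^ k / fact k)" if "s \<in> ?S" for k s
    proof -
      have "norm (P k s) \<le> norm y0 * (K * \<bar>s - \<tau>\<bar>) ^ k / fact k"
        by (rule picard_iterate_bound[where S = ?S and L = L])
          (use PSuc P0 pq K that in \<open>auto simp: is_interval_convex_1 subset_iff\<close>)
      also have "\<dots> \<le> norm y0 * (K * (q - p)) ^ k / fact k"
        using that pq(2) \<open>0 \<le> K\<close> by (intro divide_right_mono mult_left_mono power_mono) auto
      finally show ?thesis by simp
    qed
    have summ: "summable (\<lambda>k. norm y0 * ((K * (q - p)) ^ k / fact k))"
      using summable_exp[of "K * (q - p)"] by (intro summable_mult) (simp add: divide_inverse mult.commute)
    have unif: "uniform_limit ?S (\<lambda>n s. \<Sum>k<n. P k s) y sequentially"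
      unfolding y_def by (rule Weierstrass_m_test[OF bound summ])
    \<comment> \<open>\<open>D k\<close> is the derivative of \<open>P k\<close>, being 0 for the
      constant \<open>P 0\<close>. By the index shift, the first \<open>n + 1\<close> derivatives
      sum to \<open>L s\<close> applied to the sum of the first \<open>n\<close> terms, so uniform
      convergence passes from the series to its derivatives.\<close>
    define D where "D k s = (case k of 0 \<Rightarrow> 0 | Suc m \<Rightarrow> L s (P m s))" for k s
    have "\<exists>g. \<forall>s\<in>?S. (\<lambda>k. P k s) sums g s \<and> (g has_derivative (\<lambda>h. h *\<^sub>R L s (y s))) (at s within ?S)"
    proof (rule has_derivative_series[where f' = "\<lambda>k s h. h *\<^sub>R D k s"])
      show "(P k has_derivative (\<lambda>h. h *\<^sub>R D k s)) (at s within ?S)" if "s \<in> ?S" for k s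
      proof (cases k)
        case 0
        have "P 0 = (\<lambda>_. y0)" using P0 by auto
        with 0 show ?thesis by (simp add: D_def)
      next
        case (Suc m)
        have "s \<in> I" using that pq(1) by auto
        then have "(P k has_vector_derivative D k s) (at s)"
          using PSuc[of m] Suc by (simp add: D_def)
        then show ?thesis
          unfolding has_vector_derivative_def by (rule has_derivative_at_withinI)
      qed
    next
      fix e :: real assume "e > 0"
      \<comment> \<open>Dividing \<open>e\<close> by \<open>K + 1\<close> instead of
        \<open>K\<close> covers the case \<open>K = 0\<close>.\<close>
      have "K + 1 > 0" using \<open>0 \<le> K\<close> by simp
      then have "\<forall>\<^sub>F n in sequentially. \<forall>s\<in>?S. dist (\<Sum>k<n. P k s) (y s) < e / (K + 1)"
        using unif \<open>e > 0\<close> by (intro uniform_limitD) auto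
      then have "\<forall>\<^sub>F n in sequentially. \<forall>s\<in>?S. \<forall>h.
          norm ((\<Sum>k<Suc n. h *\<^sub>R D k s) - h *\<^sub>R L s (y s)) \<le> e * norm h"
      proof (rule eventually_mono, intro ballI allI)
        fix n s and h :: real
        assume near: "\<forall>s\<in>?S. dist (\<Sum>k<n. P k s) (y s) < e / (K + 1)" and s: "s \<in> ?S"
        have "(\<Sum>k<Suc n. h *\<^sub>R D k s) = h *\<^sub>R L s (\<Sum>k<n. P k s)"
          by (simp add: sum.lessThan_Suc_shift D_def blinfun.sum_right scaleR_sum_right del: sum.lessThan_Suc)
        then have "norm ((\<Sum>k<Suc n. h *\<^sub>R D k s) - h *\<^sub>R L s (y s))
            = \<bar>h\<bar> * norm (L s ((\<Sum>k<n. P k s) - y s))"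
          by (metis blinfun.diff_right norm_scaleR scaleR_diff_right)
        also have "\<dots> \<le> \<bar>h\<bar> * (norm (L s) * norm ((\<Sum>k<n. P k s) - y s))"
          by (intro mult_left_mono norm_blinfun) simp
        also have "\<dots> \<le> \<bar>h\<bar> * ((K + 1) * (e / (K + 1)))"
          using near[rule_format, OF s] K[of s] s \<open>0 \<le> K\<close>
          by (intro mult_left_mono mult_mono) (auto simp: dist_norm)
        also have "\<dots> = e * norm h"
          using \<open>K + 1 > 0\<close> by (simp add: mult.commute)
        finally show "norm ((\<Sum>k<Suc n. h *\<^sub>R D k s) - h *\<^sub>R L s (y s)) \<le> e * norm h" .
      qed
      then show "\<forall>\<^sub>F n in sequentially. \<forall>s\<in>?S. \<forall>h.
          norm ((\<Sum>k<n. h *\<^sub>R D k s) - h *\<^sub>R L s (y s)) \<le> e * norm h"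
        using eventually_sequentially_Suc[of "\<lambda>n. \<forall>s\<in>?S. \<forall>h.
          norm ((\<Sum>k<n. h *\<^sub>R D k s) - h *\<^sub>R L s (y s)) \<le> e * norm h"] by blast
    next
      show "(\<lambda>k. P k t) sums y t"
        unfolding sums_def using tendsto_uniform_limitI[OF unif pq(3)] .
    qed (use pq in auto)
    then obtain g where g: "\<And>s. s \<in> ?S \<Longrightarrow> (\<lambda>k. P k s) sums g s"
        "(g has_vector_derivative L t (y t)) (at t within ?S)"
      using pq(3) unfolding has_vector_derivative_def by blast
    have "g s = y s" if "s \<in> ?S" for s
      using g(1)[OF that] unfolding y_def by (simp add: sums_iff)
    then show "(y has_vector_derivative L t (y t)) (at t)"
      using g(2) pq(3) by (metis has_vector_derivative_transform_within_open at_within_open open_greaterThanLessThan)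
  qed
qed

subsection \<open>From the Riccati equation to fractional linear solutions\<close>

text \<open>Instead of dividing a linear solution and asking where its denominator vanishes, a given
  solution \<open>x\<close> is lifted to \<open>(v x, v)\<close> with \<open>v\<close> an
  exponential. Hence the denominator is nonzero on all of \<open>J\<close>, and the blocks depend on
  \<open>t\<close> and \<tau> alone.\<close>

lemma riccati_imp_fractional_linear:
  fixes a c :: "real \<Rightarrow> real^'n" and B :: "real \<Rightarrow> real^'n^'n"
  assumes I: "open I" "is_interval I"
    and cont: "continuous_on I a" "continuous_on I B" "continuous_on I c"
    and f: "\<And>t x. t \<in> I \<Longrightarrow> f t x = a t + B t *v x + (c t \<bullet> x) *\<^sub>R x"
  obtains A :: "real \<Rightarrow> real \<Rightarrow> real^'n^'n" and \<beta> \<gamma> :: "real \<Rightarrow> real \<Rightarrow> real^'n"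
    and \<delta> :: "real \<Rightarrow> real \<Rightarrow> real"
  where "\<And>t \<tau>. t \<in> I \<Longrightarrow> \<tau> \<in> I \<Longrightarrow> \<not> (\<gamma> t \<tau> = 0 \<and> \<delta> t \<tau> = 0)"
    and "\<And>J x t \<tau>. ode_solution I f J x \<Longrightarrow> \<tau> \<in> J \<Longrightarrow> t \<in> J \<Longrightarrow>
      \<gamma> t \<tau> \<bullet> x \<tau> + \<delta> t \<tau> \<noteq> 0 \<and>
      x t = (A t \<tau> *v x \<tau> + \<beta> t \<tau>) /\<^sub>R (\<gamma> t \<tau> \<bullet> x \<tau> + \<delta> t \<tau>)"
proof -
  define L :: "real \<Rightarrow> ((real^'n) \<times> real) \<Rightarrow>\<^sub>L ((real^'n) \<times> real)"
    where "L t = Blinfun (\<lambda>w. (B t *v fst w + snd w *\<^sub>R a t, - (c t \<bullet> fst w)))" for t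
  have L_apply: "L t w = (B t *v fst w + snd w *\<^sub>R a t, - (c t \<bullet> fst w))" for t w
  proof -
    have "linear (\<lambda>w. (B t *v fst w + snd w *\<^sub>R a t, - (c t \<bullet> fst w)))"
      by (rule linearI) (auto simp: algebra_simps inner_add_right matrix_vector_mult_scaleR)
    then show ?thesis
      unfolding L_def by (subst bounded_linear_Blinfun_apply) (auto simp: linear_conv_bounded_linear)
  qed
  have L_cont: "continuous_on I L"
    by (rule continuous_on_blinfun_componentwise)
      (auto simp: L_apply matrix_vector_mult_def intro!: continuous_intros cont
        continuous_on_vec_lambda)
  have "\<exists>y. y \<tau> = w \<and> (\<forall>t\<in>I. (y has_vector_derivative L t (y t)) (at t))" if "\<tau> \<in> I" for \<tau> w
    using linear_ode_exists[OF I that L_cont] by metis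
  then obtain Y where Y_init: "\<And>\<tau> w. \<tau> \<in> I \<Longrightarrow> Y \<tau> w \<tau> = w"
    and Y_der: "\<And>\<tau> w t. \<tau> \<in> I \<Longrightarrow> t \<in> I \<Longrightarrow> (Y \<tau> w has_vector_derivative L t (Y \<tau> w t)) (at t)"
    by metis
  have Y_unique: "y t = Y \<tau> (y \<tau>) t"
    if "is_interval J" "J \<subseteq> I" "\<tau> \<in> J" "t \<in> J"
      "\<And>s. s \<in> J \<Longrightarrow> (y has_vector_derivative L s (y s)) (at s)" for J y \<tau> t
    by (rule linear_ode_unique[OF that(1,3,4) continuous_on_subset[OF L_cont that(2)] that(5)])
      (simp_all add: Y_init Y_der subsetD[OF that(2)] that(3))
  \<comment> \<open>Superposition: sums and multiples of solutions solve the system, and uniqueness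
    identifies them by their values at \<tau>.\<close>
  have Y_lin: "linear (\<lambda>w. Y \<tau> w t)" if "t \<in> I" "\<tau> \<in> I" for t \<tau>
  proof (rule linearI)
    fix v w and r :: real
    have "((\<lambda>t. Y \<tau> v t + Y \<tau> w t) has_vector_derivative L s (Y \<tau> v s + Y \<tau> w s)) (at s)"
      "((\<lambda>t. r *\<^sub>R Y \<tau> w t) has_vector_derivative L s (r *\<^sub>R Y \<tau> w s)) (at s)" if "s \<in> I" for s
      unfolding blinfun.add_right blinfun.scaleR_right using Y_der[OF \<open>\<tau> \<in> I\<close> that]
      by (blast intro: has_vector_derivative_add
          bounded_linear.has_vector_derivative[OF bounded_linear_scaleR_right])+
    from Y_unique[OF I(2) subset_refl that(2,1) this(1)] Y_unique[OF I(2) subset_refl that(2,1) this(2)]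
    show "Y \<tau> (v + w) t = Y \<tau> v t + Y \<tau> w t" "Y \<tau> (r *\<^sub>R w) t = r *\<^sub>R Y \<tau> w t"
      by (simp_all add: Y_init that)
  qed
  define A where "A t \<tau> = matrix (\<lambda>\<xi>. fst (Y \<tau> (\<xi>, 0) t))" for t \<tau>
  define \<beta> where "\<beta> t \<tau> = fst (Y \<tau> (0, 1) t)" for t \<tau>
  define \<gamma> :: "real \<Rightarrow> real \<Rightarrow> real^'n" where "\<gamma> t \<tau> = (\<chi> i. snd (Y \<tau> (axis i 1, 0) t))" for t \<tau>
  define \<delta> where "\<delta> t \<tau> = snd (Y \<tau> (0, 1) t)" for t \<tau>
  have Y_blocks: "Y \<tau> (\<xi>, s) t = (A t \<tau> *v \<xi> + s *\<^sub>R \<beta> t \<tau>, \<gamma> t \<tau> \<bullet> \<xi> + s * \<delta> t \<tau>)"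
    if t: "t \<in> I" and \<tau>: "\<tau> \<in> I" for t \<tau> \<xi> s
  proof -
    have lin: "linear (\<lambda>\<xi>. Y \<tau> (\<xi>, 0) t)"
      using linear_compose[OF _ Y_lin[OF t \<tau>], of "\<lambda>\<xi>. (\<xi>, 0)"] by (simp add: o_def linear_iff)
    have "linear (\<lambda>\<xi>. fst (Y \<tau> (\<xi>, 0) t))" "linear (\<lambda>\<xi>. snd (Y \<tau> (\<xi>, 0) t))"
      using linear_compose[OF lin linear_fst] linear_compose[OF lin linear_snd] by (simp_all add: o_def)
    then have "Y \<tau> (\<xi>, 0) t = (A t \<tau> *v \<xi>, \<gamma> t \<tau> \<bullet> \<xi>)"
      unfolding A_def \<gamma>_def by (simp add: linear_functional_inner[where g = "\<lambda>\<xi>. snd (Y \<tau> (\<xi>, 0) t)"])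
    moreover have "Y \<tau> (\<xi>, s) t = Y \<tau> (\<xi>, 0) t + s *\<^sub>R Y \<tau> (0, 1) t"
      using linear_add[OF Y_lin[OF t \<tau>], of "(\<xi>, 0)" "s *\<^sub>R (0, 1)"]
        linear_scale[OF Y_lin[OF t \<tau>], of s "(0, 1)"] by simp
    ultimately show ?thesis
      by (simp add: \<beta>_def \<delta>_def prod_eq_iff)
  qed
  show thesis
  proof (rule that[of \<gamma> \<delta> A \<beta>])
    fix t \<tau> assume t: "t \<in> I" and \<tau>: "\<tau> \<in> I"
    \<comment> \<open>Transport \<open>(0, 1)\<close> from \<open>t\<close> back to \<tau>. Going
      forward again returns \<open>(0, 1)\<close>, whose last component would be 0 if
      \<open>\<gamma> t \<tau>\<close> and \<open>\<delta> t \<tau>\<close> both vanished.\<close>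
    obtain \<xi> s where w: "Y t (0, 1) \<tau> = (\<xi>, s)" by fastforce
    have "(0, 1) = Y \<tau> (\<xi>, s) t"
      using Y_unique[of I \<tau> t "Y t (0, 1)"] I t \<tau> by (simp add: Y_init Y_der w)
    then show "\<not> (\<gamma> t \<tau> = 0 \<and> \<delta> t \<tau> = 0)"
      using Y_blocks[OF t \<tau>] by auto
  next
    fix J x t \<tau>
    assume sol: "ode_solution I f J x" and \<tau>: "\<tau> \<in> J" and t: "t \<in> J"
    have J: "open J" "is_interval J" "J \<subseteq> I"
      and x_der: "\<And>s. s \<in> J \<Longrightarrow> (x has_vector_derivative f s (x s)) (at s)"
      using sol by (auto simp: ode_solution_def)
    have x_cont: "continuous_on J x"
      using x_der by (intro continuous_at_imp_continuous_on) (blast intro: has_vector_derivative_continuous)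
    have cx_cont: "continuous_on J (\<lambda>s. c s \<bullet> x s)"
      using cont(3) J(3) x_cont by (intro continuous_on_inner) (auto elim: continuous_on_subset)
    obtain C where C_init: "C \<tau> = 0"
      and C_der: "\<And>s. s \<in> J \<Longrightarrow> (C has_vector_derivative c s \<bullet> x s) (at s)"
      by (rule open_interval_antiderivative[OF J(1,2) \<tau> cx_cont]) (rule that; assumption)
    \<comment> \<open>The denominator: the solution of \<open>v' = - (c \<bullet> x) v\<close> with \<open>v \<tau> = 1\<close>.\<close>
    define v where "v s = exp (- C s)" for s
    have v_der: "(v has_vector_derivative - (c s \<bullet> x s) * v s) (at s)" if "s \<in> J" for s
      using C_der[OF that] unfolding v_def has_real_derivative_iff_has_vector_derivative[symmetric]
      by (auto intro!: derivative_eq_intros)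
    define w where "w s = (v s *\<^sub>R x s, v s)" for s
    \<comment> \<open>In the derivative of \<open>v x\<close>, the term from \<open>v'\<close>
      cancels the quadratic term of \<open>f\<close>, leaving \<open>B (v x) + v a\<close>.\<close>
    have w_der: "(w has_vector_derivative L s (w s)) (at s)" if s: "s \<in> J" for s
    proof -
      have "((\<lambda>s. (v s *\<^sub>R x s, v s)) has_vector_derivative
          (v s *\<^sub>R f s (x s) + (- (c s \<bullet> x s) * v s) *\<^sub>R x s, - (c s \<bullet> x s) * v s)) (at s)"
        using v_der[OF s] by (intro has_vector_derivative_Pair has_vector_derivative_scaleR x_der[OF s])
          (auto simp: has_real_derivative_iff_has_vector_derivative)
      moreover have "s \<in> I" using s J by auto
      ultimately show ?thesis
        unfolding w_def
        by (simp add: L_apply f matrix_vector_mult_scaleR scaleR_add_right mult.commute add.commute)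
    qed
    have "w t = Y \<tau> (x \<tau>, 1) t"
      using Y_unique[of J \<tau> t w] J \<tau> t w_der by (simp add: w_def v_def C_init)
    then have "v t *\<^sub>R x t = A t \<tau> *v x \<tau> + \<beta> t \<tau>" "v t = \<gamma> t \<tau> \<bullet> x \<tau> + \<delta> t \<tau>"
      using Y_blocks[OF subsetD[OF J(3) t] subsetD[OF J(3) \<tau>], of "x \<tau>" 1] by (auto simp: w_def)
    moreover have "v t \<noteq> 0" by (simp add: v_def)
    ultimately show "\<gamma> t \<tau> \<bullet> x \<tau> + \<delta> t \<tau> \<noteq> 0 \<and>
        x t = (A t \<tau> *v x \<tau> + \<beta> t \<tau>) /\<^sub>R (\<gamma> t \<tau> \<bullet> x \<tau> + \<delta> t \<tau>)"
      by (metis scaleR_scaleR left_inverse scaleR_one)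
  qed
qed

subsection \<open>From fractional linear solutions to the Riccati equation\<close>

text \<open>\<open>G v\<close> is the derivative at \<tau> of
  \<open>\<gamma> t \<bullet> v / \<delta> t\<close>: differentiating the identity without
  \<open>A\<close> gives \<open>2 G(v) v = 2 F(0) - F(v) - F(- v)\<close>, and pairing with
  \<open>v\<close> isolates \<open>G v\<close>. All regularity in \<open>t\<close> is drawn from
  \<phi>; at \<open>v = 0\<close> the convention \<open>0 / 0 = 0\<close> gives the value linearity
  demands.\<close>

lemma fractional_linear_derivative:
  fixes \<phi> :: "real \<Rightarrow> real^'n \<Rightarrow> real^'n" and F :: "real^'n \<Rightarrow> real^'n"
    and A :: "real \<Rightarrow> real^'n^'n" and \<beta> \<gamma> :: "real \<Rightarrow> real^'n" and \<delta> :: "real \<Rightarrow> real"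
  assumes frac: "\<And>\<xi>. \<forall>\<^sub>F t in at \<tau>. \<gamma> t \<bullet> \<xi> + \<delta> t \<noteq> 0 \<and>
        \<phi> t \<xi> = (A t *v \<xi> + \<beta> t) /\<^sub>R (\<gamma> t \<bullet> \<xi> + \<delta> t)"
    and init: "\<And>\<xi>. \<phi> \<tau> \<xi> = \<xi>"
    and der: "\<And>\<xi>. ((\<lambda>t. \<phi> t \<xi>) has_vector_derivative F \<xi>) (at \<tau>)"
  defines "G \<equiv> \<lambda>v. v \<bullet> (2 *\<^sub>R F 0 - F v - F (- v)) / (2 * (v \<bullet> v))"
  shows "linear G" and "linear (\<lambda>v. F v + G v *\<^sub>R v - F 0)"
proof -
  have q: "((\<lambda>t. (\<phi> t \<xi> - \<xi>) /\<^sub>R (t - \<tau>)) \<longlongrightarrow> F \<xi>) (at \<tau>)" for \<xi>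
  proof (rule LIM_zero_cancel, rule tendsto_norm_zero_cancel)
    have "((\<lambda>t. norm ((\<phi> t \<xi> - \<xi> - (t - \<tau>) *\<^sub>R F \<xi>) /\<^sub>R \<bar>t - \<tau>\<bar>)) \<longlongrightarrow> 0) (at \<tau>)"
      using der[of \<xi>] init[of \<xi>] unfolding has_vector_derivative_def has_derivative_at_within
      by (intro tendsto_norm_zero) simp
    moreover have "norm ((\<phi> t \<xi> - \<xi> - (t - \<tau>) *\<^sub>R F \<xi>) /\<^sub>R \<bar>t - \<tau>\<bar>)
        = norm ((\<phi> t \<xi> - \<xi>) /\<^sub>R (t - \<tau>) - F \<xi>)" if "t \<noteq> \<tau>" for t
    proof -
      have "(\<phi> t \<xi> - \<xi>) /\<^sub>R (t - \<tau>) - F \<xi> = (\<phi> t \<xi> - \<xi> - (t - \<tau>) *\<^sub>R F \<xi>) /\<^sub>R (t - \<tau>)"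
        using that by (simp add: scaleR_diff_right)
      then show ?thesis by simp
    qed
    then have "\<forall>\<^sub>F t in at \<tau>. norm ((\<phi> t \<xi> - \<xi> - (t - \<tau>) *\<^sub>R F \<xi>) /\<^sub>R \<bar>t - \<tau>\<bar>)
        = norm ((\<phi> t \<xi> - \<xi>) /\<^sub>R (t - \<tau>) - F \<xi>)"
      unfolding eventually_at_filter by (intro always_eventually) blast
    ultimately show "((\<lambda>t. norm ((\<phi> t \<xi> - \<xi>) /\<^sub>R (t - \<tau>) - F \<xi>)) \<longlongrightarrow> 0) (at \<tau>)"
      by (rule Lim_transform_eventually)
  qed
  have lim: "((\<lambda>t. \<phi> t \<xi>) \<longlongrightarrow> \<xi>) (at \<tau>)" for \<xi>
    using has_vector_derivative_continuous[OF der[of \<xi>]] init[of \<xi>] by (simp add: continuous_within)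
  have ev_tau: "\<forall>\<^sub>F t in at \<tau>. t \<noteq> \<tau>"
    by (simp add: eventually_at_filter)
  \<comment> \<open>The denominator at \<open>\<xi> = 0\<close> is \<open>\<delta> t\<close>, so it
    is nonzero near \<tau> and can be normalised to 1.\<close>
  have clear: "\<forall>\<^sub>F t in at \<tau>. \<delta> t \<noteq> 0 \<and> \<phi> t 0 = \<beta> t /\<^sub>R \<delta> t \<and>
      (1 + \<gamma> t \<bullet> \<xi> / \<delta> t) *\<^sub>R \<phi> t \<xi> = (A t *v \<xi>) /\<^sub>R \<delta> t + \<phi> t 0" for \<xi>
    using frac[of 0] frac[of \<xi>]
  proof eventually_elim
    case (elim t)
    then have "\<delta> t \<noteq> 0" "\<phi> t 0 = \<beta> t /\<^sub>R \<delta> t" by auto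
    moreover have "1 + \<gamma> t \<bullet> \<xi> / \<delta> t = (\<gamma> t \<bullet> \<xi> + \<delta> t) / \<delta> t"
      using \<open>\<delta> t \<noteq> 0\<close> by (simp add: field_simps)
    moreover have "(1 + \<gamma> t \<bullet> \<xi> / \<delta> t) *\<^sub>R \<phi> t \<xi> = (A t *v \<xi> + \<beta> t) /\<^sub>R \<delta> t"
      unfolding \<open>1 + _ = _\<close> using elim(2) by (simp add: divide_inverse_commute flip: scaleR_add_right)
    ultimately show ?case
      by (simp add: scaleR_add_right)
  qed
  have G_lim: "((\<lambda>t. (\<gamma> t \<bullet> v / \<delta> t) / (t - \<tau>)) \<longlongrightarrow> G v) (at \<tau>)" for v
  proof (cases "v = 0")
    case True
    then show ?thesis by (simp add: G_def)
  next
    case False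
    \<comment> \<open>\<open>N\<close> is the difference quotient of
      \<open>v \<bullet> (2 \<phi>(0) - \<phi>(v) - \<phi>(- v))\<close>, an expression vanishing at
      \<tau>; \<open>D\<close> tends to \<open>2 * (v \<bullet> v)\<close>, which is nonzero. Their
      quotient is the difference quotient sought.\<close>
    define N where "N t = v \<bullet> (2 *\<^sub>R ((\<phi> t 0 - 0) /\<^sub>R (t - \<tau>)) - (\<phi> t v - v) /\<^sub>R (t - \<tau>)
        - (\<phi> t (- v) - (- v)) /\<^sub>R (t - \<tau>))" for t
    define D where "D t = v \<bullet> (\<phi> t v - \<phi> t (- v))" for t
    have "(D \<longlongrightarrow> v \<bullet> v - v \<bullet> (- v)) (at \<tau>)"
      unfolding D_def inner_diff_right by (intro tendsto_intros lim)
    then have D: "(D \<longlongrightarrow> 2 * (v \<bullet> v)) (at \<tau>)"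
      by simp
    have "(N \<longlongrightarrow> v \<bullet> (2 *\<^sub>R F 0 - F v - F (- v))) (at \<tau>)"
      unfolding N_def by (intro tendsto_intros q)
    then have "((\<lambda>t. N t / D t) \<longlongrightarrow> G v) (at \<tau>)"
      using tendsto_divide[OF _ D] False by (simp add: G_def)
    moreover have "\<forall>\<^sub>F t in at \<tau>. D t \<noteq> 0"
      using tendsto_imp_eventually_ne[OF D] False by simp
    then have "\<forall>\<^sub>F t in at \<tau>. N t / D t = (\<gamma> t \<bullet> v / \<delta> t) / (t - \<tau>)"
      using clear[of v] clear[of "- v"] ev_tau
    proof eventually_elim
      case (elim t)
      define g where "g = \<gamma> t \<bullet> v / \<delta> t"
      have "(1 + g) *\<^sub>R \<phi> t v + (1 - g) *\<^sub>R \<phi> t (- v) = \<phi> t 0 + \<phi> t 0"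
        using elim by (simp add: g_def linear_neg[OF matrix_vector_mul_linear])
      then have "g *\<^sub>R (\<phi> t v - \<phi> t (- v)) = 2 *\<^sub>R \<phi> t 0 - \<phi> t v - \<phi> t (- v)"
        unfolding scaleR_2 by (simp add: algebra_simps)
      then have "g * D t = v \<bullet> (2 *\<^sub>R \<phi> t 0 - \<phi> t v - \<phi> t (- v))"
        unfolding D_def by (metis inner_scaleR_right)
      moreover have "N t = v \<bullet> (2 *\<^sub>R \<phi> t 0 - \<phi> t v - \<phi> t (- v)) / (t - \<tau>)"
        unfolding N_def by (simp add: inner_diff_right inner_add_right divide_inverse algebra_simps)
      ultimately show ?case
        using elim by (simp add: g_def[symmetric] field_simps)
    qed
    ultimately show ?thesis by (rule Lim_transform_eventually)
  qed
  \<comment> \<open>With the limit for \<gamma> known, the normalised identity is solved for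
    \<open>A t *v v\<close> and its difference quotient converges by the product rule.\<close>
  have N_lim: "((\<lambda>t. ((A t *v v) /\<^sub>R \<delta> t - v) /\<^sub>R (t - \<tau>)) \<longlongrightarrow> F v + G v *\<^sub>R v - F 0) (at \<tau>)" for v
  proof (rule Lim_transform_eventually)
    show "((\<lambda>t. (\<phi> t v - v) /\<^sub>R (t - \<tau>) + ((\<gamma> t \<bullet> v / \<delta> t) / (t - \<tau>)) *\<^sub>R \<phi> t v
        - (\<phi> t 0 - 0) /\<^sub>R (t - \<tau>)) \<longlongrightarrow> F v + G v *\<^sub>R v - F 0) (at \<tau>)"
      by (intro tendsto_intros q lim G_lim)
    show "\<forall>\<^sub>F t in at \<tau>. (\<phi> t v - v) /\<^sub>R (t - \<tau>) + ((\<gamma> t \<bullet> v / \<delta> t) / (t - \<tau>)) *\<^sub>R \<phi> t v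
        - (\<phi> t 0 - 0) /\<^sub>R (t - \<tau>) = ((A t *v v) /\<^sub>R \<delta> t - v) /\<^sub>R (t - \<tau>)"
      using clear[of v]
    proof eventually_elim
      case (elim t)
      then have eq: "(A t *v v) /\<^sub>R \<delta> t = (1 + \<gamma> t \<bullet> v / \<delta> t) *\<^sub>R \<phi> t v - \<phi> t 0"
        by simp
      show ?case
        unfolding eq by (simp add: algebra_simps divide_inverse)
    qed
  qed
  \<comment> \<open>For fixed \<open>t\<close> the quotients are additive and homogeneous in
    \<open>v\<close> (for \<open>A\<close>, since the subtracted \<open>v\<close> is linear too);
    uniqueness of limits carries this over.\<close>
  show "linear G"
  proof (rule linearI)
    fix v w and r :: real
    show "G (v + w) = G v + G w"
      using tendsto_unique[OF _ G_lim[of "v + w"]] tendsto_add[OF G_lim[of v] G_lim[of w]]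
      by (simp add: inner_add_right add_divide_distrib)
    show "G (r *\<^sub>R v) = r *\<^sub>R G v"
      using tendsto_unique[OF _ G_lim[of "r *\<^sub>R v"]] tendsto_mult_left[OF G_lim[of v], of r]
      by simp
  qed
  show "linear (\<lambda>v. F v + G v *\<^sub>R v - F 0)" (is "linear ?N")
  proof (rule linearI)
    fix v w and r :: real
    have "?N v + ?N w = ?N (v + w)"
    proof (rule tendsto_unique[OF _ tendsto_add[OF N_lim[of v] N_lim[of w]]])
      show "((\<lambda>t. ((A t *v v) /\<^sub>R \<delta> t - v) /\<^sub>R (t - \<tau>) + ((A t *v w) /\<^sub>R \<delta> t - w) /\<^sub>R (t - \<tau>))
          \<longlongrightarrow> ?N (v + w)) (at \<tau>)"
        using N_lim[of "v + w"] by (simp add: algebra_simps)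
    qed simp
    then show "?N (v + w) = ?N v + ?N w" by simp
    have "r *\<^sub>R ?N v = ?N (r *\<^sub>R v)"
    proof (rule tendsto_unique[OF _ tendsto_scaleR[OF tendsto_const N_lim[of v]]])
      show "((\<lambda>t. r *\<^sub>R (((A t *v v) /\<^sub>R \<delta> t - v) /\<^sub>R (t - \<tau>))) \<longlongrightarrow> ?N (r *\<^sub>R v)) (at \<tau>)"
        using N_lim[of "r *\<^sub>R v"] by (simp add: algebra_simps matrix_vector_mult_scaleR)
    qed simp
    then show "?N (r *\<^sub>R v) = r *\<^sub>R ?N v" by simp
  qed
qed

text \<open>Solving the second linear map for \<open>f t v\<close> puts \<open>- G t\<close> in the
  role of \<open>c\<close>. Continuity of the coefficients holds because each entry is an explicit
  expression in \<open>f t\<close> at fixed vectors, with denominators independent of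
  \<open>t\<close>.\<close>

lemma vector_riccatiI:
  fixes f :: "real \<Rightarrow> real^'n \<Rightarrow> real^'n"
  assumes cont: "continuous_on (I \<times> UNIV) (\<lambda>(t, x). f t x)"
    and G: "G = (\<lambda>t v. v \<bullet> (2 *\<^sub>R f t 0 - f t v - f t (- v)) / (2 * (v \<bullet> v)))"
    and lin: "\<And>t. t \<in> I \<Longrightarrow> linear (G t)" "\<And>t. t \<in> I \<Longrightarrow> linear (\<lambda>v. f t v + G t v *\<^sub>R v - f t 0)"
  shows "vector_riccati I f"
proof -
  define c :: "real \<Rightarrow> real^'n" where "c t = - (\<chi> i. G t (axis i 1))" for t
  define B where "B t = matrix (\<lambda>v. f t v + G t v *\<^sub>R v - f t 0)" for t
  have f_cont: "continuous_on I (\<lambda>t. f t x)" for x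
  proof -
    have "continuous_on I ((\<lambda>(t, x). f t x) \<circ> (\<lambda>t. (t, x)))"
      by (intro continuous_on_compose continuous_intros continuous_on_subset[OF cont]) auto
    then show ?thesis by (simp add: o_def)
  qed
  have G_cont: "continuous_on I (\<lambda>t. G t v)" for v
    unfolding G by (cases "v = 0") (auto intro!: continuous_intros f_cont)
  have "continuous_on I c"
    unfolding c_def by (intro continuous_intros continuous_on_vec_lambda G_cont)
  moreover have "continuous_on I B"
    unfolding B_def matrix_def by (intro continuous_intros continuous_on_vec_lambda G_cont f_cont)
  moreover have "f t x = f t 0 + B t *v x + (c t \<bullet> x) *\<^sub>R x" if "t \<in> I" for t x
    using lin[OF that] unfolding B_def c_def
    by (simp add: linear_functional_inner[OF lin(1)[OF that]] inner_minus_left)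
  ultimately show ?thesis
    unfolding vector_riccati_def using f_cont[of 0] by blast
qed

section \<open>The equivalence for maximal solutions\<close>

theorem theorem6p1:
  fixes I :: "real set"
    and f :: "real \<Rightarrow> real^'n \<Rightarrow> real^'n"
    and \<phi> :: "real \<Rightarrow> real \<Rightarrow> real^'n \<Rightarrow> real^'n"
    and Imax :: "real \<Rightarrow> real^'n \<Rightarrow> real set"
  assumes "open I" and "is_interval I" and "I \<noteq> {}"
    and "continuous_on (I \<times> UNIV) (\<lambda>(t, x). f t x)"
    and "Ck_in_x 3 I f"
    and "\<And>\<tau> \<xi>. \<tau> \<in> I \<Longrightarrow> maximal_solution I f \<tau> \<xi> (Imax \<tau> \<xi>) (\<lambda>t. \<phi> t \<tau> \<xi>)"
  shows "vector_riccati I f \<longleftrightarrow>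
    (\<exists>(A :: real \<Rightarrow> real \<Rightarrow> real^'n^'n) (\<beta> :: real \<Rightarrow> real \<Rightarrow> real^'n)
      (\<gamma> :: real \<Rightarrow> real \<Rightarrow> real^'n) (\<delta> :: real \<Rightarrow> real \<Rightarrow> real).
      (\<forall>t\<in>I. \<forall>\<tau>\<in>I. \<not> (\<gamma> t \<tau> = 0 \<and> \<delta> t \<tau> = 0)) \<and>
      (\<forall>\<tau>\<in>I. \<forall>\<xi>. \<forall>t\<in>Imax \<tau> \<xi>.
         \<gamma> t \<tau> \<bullet> \<xi> + \<delta> t \<tau> \<noteq> 0 \<and>
         \<phi> t \<tau> \<xi> = (A t \<tau> *v \<xi> + \<beta> t \<tau>) /\<^sub>R (\<gamma> t \<tau> \<bullet> \<xi> + \<delta> t \<tau>)))"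
    (is "_ \<longleftrightarrow> ?fractional")
proof
  have sol: "ode_solution I f (Imax \<tau> \<xi>) (\<lambda>t. \<phi> t \<tau> \<xi>)" "\<tau> \<in> Imax \<tau> \<xi>" "\<phi> \<tau> \<tau> \<xi> = \<xi>"
    if "\<tau> \<in> I" for \<tau> \<xi>
    using assms(6)[OF that] by (simp_all add: maximal_solution_def)
  show ?fractional if riccati: "vector_riccati I f"
  proof -
    obtain a :: "real \<Rightarrow> real^'n" and B :: "real \<Rightarrow> real^'n^'n" and c :: "real \<Rightarrow> real^'n"
      where abc: "continuous_on I a" "continuous_on I B" "continuous_on I c"
        "\<And>t x. t \<in> I \<Longrightarrow> f t x = a t + B t *v x + (c t \<bullet> x) *\<^sub>R x"
      using riccati unfolding vector_riccati_def by blast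
    obtain A :: "real \<Rightarrow> real \<Rightarrow> real^'n^'n" and \<beta> \<gamma> :: "real \<Rightarrow> real \<Rightarrow> real^'n"
        and \<delta> :: "real \<Rightarrow> real \<Rightarrow> real"
      where nz: "\<And>t \<tau>. t \<in> I \<Longrightarrow> \<tau> \<in> I \<Longrightarrow> \<not> (\<gamma> t \<tau> = 0 \<and> \<delta> t \<tau> = 0)"
        and frac: "\<And>J x t \<tau>. ode_solution I f J x \<Longrightarrow> \<tau> \<in> J \<Longrightarrow> t \<in> J \<Longrightarrow>
          \<gamma> t \<tau> \<bullet> x \<tau> + \<delta> t \<tau> \<noteq> 0 \<and>
          x t = (A t \<tau> *v x \<tau> + \<beta> t \<tau>) /\<^sub>R (\<gamma> t \<tau> \<bullet> x \<tau> + \<delta> t \<tau>)"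
      by (rule riccati_imp_fractional_linear[OF assms(1,2) abc]) (assumption | rule that; assumption)+
    have "\<gamma> t \<tau> \<bullet> \<xi> + \<delta> t \<tau> \<noteq> 0 \<and> \<phi> t \<tau> \<xi> = (A t \<tau> *v \<xi> + \<beta> t \<tau>) /\<^sub>R (\<gamma> t \<tau> \<bullet> \<xi> + \<delta> t \<tau>)"
      if "\<tau> \<in> I" "t \<in> Imax \<tau> \<xi>" for \<tau> \<xi> t
      using frac[OF sol(1,2)[OF that(1)] that(2)] sol(3)[OF that(1)] by simp
    with nz show ?thesis by blast
  qed
  show "vector_riccati I f" if fractional: ?fractional
  proof -
    obtain A :: "real \<Rightarrow> real \<Rightarrow> real^'n^'n" and \<beta> \<gamma> :: "real \<Rightarrow> real \<Rightarrow> real^'n"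
        and \<delta> :: "real \<Rightarrow> real \<Rightarrow> real"
      where frac: "\<And>\<tau> \<xi> t. \<tau> \<in> I \<Longrightarrow> t \<in> Imax \<tau> \<xi> \<Longrightarrow> \<gamma> t \<tau> \<bullet> \<xi> + \<delta> t \<tau> \<noteq> 0 \<and>
         \<phi> t \<tau> \<xi> = (A t \<tau> *v \<xi> + \<beta> t \<tau>) /\<^sub>R (\<gamma> t \<tau> \<bullet> \<xi> + \<delta> t \<tau>)"
      using fractional by blast
    \<comment> \<open>The neighbourhood of \<tau> may shrink with \<xi>; this is harmless, as each
      limit involves only the initial values 0, \<open>v\<close> and \<open>- v\<close>.\<close>
    have ev: "\<forall>\<^sub>F t in at \<tau>. \<gamma> t \<tau> \<bullet> \<xi> + \<delta> t \<tau> \<noteq> 0 \<and>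
         \<phi> t \<tau> \<xi> = (A t \<tau> *v \<xi> + \<beta> t \<tau>) /\<^sub>R (\<gamma> t \<tau> \<bullet> \<xi> + \<delta> t \<tau>)" if "\<tau> \<in> I" for \<tau> \<xi>
    proof -
      have "\<forall>\<^sub>F t in at \<tau>. t \<in> Imax \<tau> \<xi>"
        using sol(1,2)[OF that, of \<xi>] by (intro eventually_at_in_open') (auto simp: ode_solution_def)
      then show ?thesis
        by (rule eventually_mono) (use frac that in blast)
    qed
    have der: "((\<lambda>t. \<phi> t \<tau> \<xi>) has_vector_derivative f \<tau> \<xi>) (at \<tau>)" if "\<tau> \<in> I" for \<tau> \<xi>
      using sol[OF that, of \<xi>] unfolding ode_solution_def by metis
    note lin = fractional_linear_derivative[OF ev sol(3) der]
    \<comment> \<open>\<open>refl\<close> fixes \<open>G\<close> as the explicit quotient whose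
      linearity \<open>lin\<close> provides, with \<open>f \<tau>\<close> as
      \<open>F\<close>.\<close>
    show ?thesis
      by (rule vector_riccatiI[OF assms(4) refl]) (use lin in blast)+
  qed
qed

end
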